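(* Let $G$ be a finite group, $\Omega$ a transitive right $G$-set and $H=G_\alpha$ the stabilizer of some $\alpha\in\Omega$. Let $S$ be a simple euclidean $G$-space with character $\sigma$ and essential Wythoff dimension $m=1$. Then for any $w\in W=\operatorname{Fix}_S(H)$ with $\langle w,w\rangle=1$ and all $g\in G$ we have $$\langle wg,w\rangle=\frac{\sigma(e_Hg)}{[\sigma,\sigma]}.$$
   Context: A euclidean $G$-space is a euclidean vector space on which $G$ acts from the right by orthogonal transformations. The essential Wythoff dimension of $S$ is the dimension of $W=\operatorname{Fix}_S(H)$ (the $H$-fixed vectors) over the division ring $\operatorname{End}_{\mathbb{R}G}(S)$. We set $e_H=\frac{1}{|H|}\sum_{h\in H}h\in\mathbb{R}G$, and $\sigma$ is extended linearly to $\mathbb{R}G$, so $\sigma(e_Hg)=\frac{1}{|H|}\sum_{h\in H}\sigma(hg)$. Also $[\sigma,\sigma]=\frac{1}{|G|}\sum_{g\in G}\sigma(g)\overline{\sigma(g)}$. *)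

theory Defs
  imports "HOL-Analysis.Analysis" "HOL-Algebra.Group"
begin

section \<open>Right actions\<close>

locale right_G_set = group G for G (structure) +
  fixes \<Omega> :: "'x set" and act :: "'x \<Rightarrow> 'g \<Rightarrow> 'x"
  assumes act_closed: "\<lbrakk>x \<in> \<Omega>; g \<in> carrier G\<rbrakk> \<Longrightarrow> act x g \<in> \<Omega>"
    and act_one: "x \<in> \<Omega> \<Longrightarrow> act x \<one> = x"
    and act_mult: "\<lbrakk>x \<in> \<Omega>; g \<in> carrier G; h \<in> carrier G\<rbrakk>
      \<Longrightarrow> act x (g \<otimes> h) = act (act x g) h"

locale transitive_right_G_set = right_G_set +
  assumes transitive: "\<lbrakk>x \<in> \<Omega>; y \<in> \<Omega>\<rbrakk> \<Longrightarrow> \<exists>g\<in>carrier G. act x g = y"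

definition right_stabilizer ::
    "('g, 'm) monoid_scheme \<Rightarrow> ('x \<Rightarrow> 'g \<Rightarrow> 'x) \<Rightarrow> 'x \<Rightarrow> 'g set" where
  "right_stabilizer G act \<alpha> = {g \<in> carrier G. act \<alpha> g = \<alpha>}"


section \<open>Euclidean \<open>G\<close>-spaces\<close>

locale euclidean_G_space = right_G_set G UNIV act
  for G :: "('g, 'm) monoid_scheme" (structure)
    and act :: "'a::euclidean_space \<Rightarrow> 'g \<Rightarrow> 'a" +
  assumes orthogonal_act:
    "g \<in> carrier G \<Longrightarrow> orthogonal_transformation (\<lambda>v. act v g)"

text \<open>The condition that a simple module is nonzero needs no mention: every type of class
  \<open>euclidean_space\<close> has positive dimension.\<close>

locale simple_euclidean_G_space = euclidean_G_space +
  assumes simple: "\<lbrakk>subspace U; \<And>u g. \<lbrakk>u \<in> U; g \<in> carrier G\<rbrakk> \<Longrightarrow> act u g \<in> U\<rbrakk>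
    \<Longrightarrow> U = {0} \<or> U = UNIV"

definition Fix :: "('a \<Rightarrow> 'g \<Rightarrow> 'a) \<Rightarrow> 'g set \<Rightarrow> 'a set" where
  "Fix act H = {v. \<forall>h\<in>H. act v h = v}"

definition End_RG ::
    "('g, 'm) monoid_scheme \<Rightarrow> ('a::real_vector \<Rightarrow> 'g \<Rightarrow> 'a) \<Rightarrow> ('a \<Rightarrow> 'a) set" where
  "End_RG G act = {f. linear f \<and> (\<forall>g\<in>carrier G. \<forall>v. f (act v g) = act (f v) g)}"


section \<open>Dimension over a division ring of endomorphisms\<close>

text \<open>A division ring \<open>D\<close> of linear endomorphisms need not be commutative, so the library's
  vector spaces over a field do not apply. The scalar multiple of \<open>v\<close> by \<open>d \<in> D\<close> is \<open>d v\<close>.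
  The definition of \<open>ring_dim\<close> follows the library's definition of \<open>dim\<close>.\<close>

definition ring_span :: "('a::real_vector \<Rightarrow> 'a) set \<Rightarrow> 'a set \<Rightarrow> 'a set" where
  "ring_span D B = {\<Sum>b\<in>T. c b b | T c. finite T \<and> T \<subseteq> B \<and> (\<forall>b\<in>T. c b \<in> D)}"

definition ring_independent :: "('a::real_vector \<Rightarrow> 'a) set \<Rightarrow> 'a set \<Rightarrow> bool" where
  "ring_independent D B \<longleftrightarrow>
    (\<forall>T c. finite T \<and> T \<subseteq> B \<and> (\<forall>b\<in>T. c b \<in> D) \<and> (\<Sum>b\<in>T. c b b) = 0
       \<longrightarrow> (\<forall>b\<in>T. c b = (\<lambda>_. 0)))"

definition ring_basis :: "('a::real_vector \<Rightarrow> 'a) set \<Rightarrow> 'a set \<Rightarrow> 'a set \<Rightarrow> bool" where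
  "ring_basis D W B \<longleftrightarrow> ring_independent D B \<and> ring_span D B = W"

definition ring_dim :: "('a::real_vector \<Rightarrow> 'a) set \<Rightarrow> 'a set \<Rightarrow> nat" where
  "ring_dim D W = (if \<exists>B. ring_basis D W B then card (SOME B. ring_basis D W B) else 0)"

definition essential_Wythoff_dim ::
    "('g, 'm) monoid_scheme \<Rightarrow> ('a::real_vector \<Rightarrow> 'g \<Rightarrow> 'a) \<Rightarrow> 'g set \<Rightarrow> nat" where
  "essential_Wythoff_dim G act H = ring_dim (End_RG G act) (Fix act H)"


section \<open>Characters and the group ring\<close>

text \<open>The trace of \<open>v \<mapsto> v g\<close> is read off from its matrix in the orthonormal basis \<open>Basis\<close>.\<close>

definition character_of :: "('a::euclidean_space \<Rightarrow> 'g \<Rightarrow> 'a) \<Rightarrow> 'g \<Rightarrow> complex" where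
  "character_of act g = complex_of_real (\<Sum>b\<in>Basis. act b g \<bullet> b)"

definition char_inner ::
    "('g, 'm) monoid_scheme \<Rightarrow> ('g \<Rightarrow> complex) \<Rightarrow> ('g \<Rightarrow> complex) \<Rightarrow> complex" where
  "char_inner G \<theta> \<psi> =
    (1 / of_nat (card (carrier G))) * (\<Sum>g\<in>carrier G. \<theta> g * cnj (\<psi> g))"

text \<open>For a finite group \<open>G\<close>, elements of \<open>\<real>G\<close> are represented by their coefficient functions.\<close>

definition gr_single :: "'g \<Rightarrow> 'g \<Rightarrow> real" where
  "gr_single g = (\<lambda>x. if x = g then 1 else 0)"

definition gr_mult ::
    "('g, 'm) monoid_scheme \<Rightarrow> ('g \<Rightarrow> real) \<Rightarrow> ('g \<Rightarrow> real) \<Rightarrow> 'g \<Rightarrow> real" where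
  "gr_mult G a b = (\<lambda>x. \<Sum>y\<in>carrier G. a y * b (inv\<^bsub>G\<^esub> y \<otimes>\<^bsub>G\<^esub> x))"

definition gr_idem :: "'g set \<Rightarrow> 'g \<Rightarrow> real" where
  "gr_idem H = (\<lambda>x. (1 / real (card H)) * (\<Sum>h\<in>H. gr_single h x))"

definition gr_extend ::
    "('g, 'm) monoid_scheme \<Rightarrow> ('g \<Rightarrow> complex) \<Rightarrow> ('g \<Rightarrow> real) \<Rightarrow> complex" where
  "gr_extend G \<theta> a = (\<Sum>x\<in>carrier G. complex_of_real (a x) * \<theta> x)"

lemma gr_extend_idem_single:
  fixes G (structure)
  assumes "group G" and fin: "finite (carrier G)" and H: "H \<subseteq> carrier G" and g: "g \<in> carrier G"
  shows "gr_extend G \<theta> (gr_mult G (gr_idem H) (gr_single g)) =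
    (1 / of_nat (card H)) * (\<Sum>h\<in>H. \<theta> (h \<otimes> g))"
proof -
  interpret group G by fact
  have finH: "finite H" using fin H finite_subset by blast
  have idem: "gr_idem H y = (if y \<in> H then 1 / real (card H) else 0)" for y
    by (simp add: gr_idem_def gr_single_def finH)
  have mult: "gr_mult G (gr_idem H) (gr_single g) x =
      (\<Sum>y\<in>H. if y \<otimes> g = x then 1 / real (card H) else 0)" if x: "x \<in> carrier G" for x
  proof -
    have "gr_mult G (gr_idem H) (gr_single g) x =
        (\<Sum>y\<in>carrier G. if y \<in> H then (if y \<otimes> g = x then 1 / real (card H) else 0) else 0)"
      unfolding gr_mult_def
    proof (rule sum.cong)
      fix y assume y: "y \<in> carrier G"
      have "inv y \<otimes> x = g \<longleftrightarrow> y \<otimes> g = x"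
        using x y g by (metis inv_closed inv_solve_left)
      then show "gr_idem H y * gr_single g (inv y \<otimes> x) =
          (if y \<in> H then (if y \<otimes> g = x then 1 / real (card H) else 0) else 0)"
        by (simp add: idem gr_single_def)
    qed simp
    also have "\<dots> = (\<Sum>y\<in>H. if y \<otimes> g = x then 1 / real (card H) else 0)"
      using fin H by (simp add: sum.inter_restrict [symmetric] Int_absorb1)
    finally show ?thesis .
  qed
  have "gr_extend G \<theta> (gr_mult G (gr_idem H) (gr_single g)) =
      (\<Sum>x\<in>carrier G. \<Sum>y\<in>H. if y \<otimes> g = x then \<theta> x / of_nat (card H) else 0)"
    unfolding gr_extend_def
    by (rule sum.cong) (auto simp: mult sum_distrib_right of_real_sum intro!: sum.cong)
  also have "\<dots> = (\<Sum>y\<in>H. \<Sum>x\<in>carrier G. if y \<otimes> g = x then \<theta> x / of_nat (card H) else 0)"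
    by (rule sum.swap)
  also have "\<dots> = (\<Sum>y\<in>H. \<theta> (y \<otimes> g) / of_nat (card H))"
    using H g fin by (intro sum.cong) (auto simp: subset_iff)
  finally show ?thesis by (simp add: sum_divide_distrib)
qed

end

theory Submission
  imports Defs
begin

text \<open>
  Let \<open>D\<close> be the ring of \<open>G\<close>-endomorphisms of \<open>S\<close>. It is closed under adjoints, so Schur's lemma,
  applied to self-adjoint endomorphisms (\<open>Schur_self_adjoint\<close>), shows that every element of \<open>D\<close>
  is a real multiple of a linear isometry (\<open>End_RG_conformal\<close>). If \<open>W\<close> has dimension 1
  over \<open>D\<close>, then \<open>W = D w\<close> for the given unit vector \<open>w\<close>, and each vector \<open>u\<close> of an orthonormal
  basis \<open>B\<close> of \<open>W\<close> is the image of \<open>w\<close> under some \<open>d \<in> D\<close> that is a linear isometry. As \<open>d\<close>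
  commutes with \<open>g\<close>, it follows that \<open>\<langle>u g, u\<rangle> = \<langle>w g, w\<rangle>\<close>.

  The element \<open>e\<^sub>H\<close> acts on \<open>S\<close> as the orthogonal projection onto \<open>W\<close>, so \<open>\<sigma>(e\<^sub>H g)\<close> is the
  trace of \<open>g\<close> compressed to \<open>W\<close> (\<open>character_idem_mult\<close>), that is
  \<open>\<Sum>u\<in>B. \<langle>u g, u\<rangle> = |B| \<langle>w g, w\<rangle>\<close>.

  It remains to see that \<open>[\<sigma>,\<sigma>] = |B|\<close>, the real dimension of \<open>D w\<close> and hence of \<open>D\<close>
  (\<open>char_norm_eq_card\<close>). Conjugation averaged over \<open>G\<close> is a projection of the space of all linear
  maps onto \<open>D\<close>. Its trace is \<open>[\<sigma>,\<sigma>]\<close> when computed on the rank one maps \<open>v \<mapsto> \<langle>v, b\<rangle> c\<close>, with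
  \<open>b\<close> and \<open>c\<close> in an orthonormal basis of \<open>S\<close>, and it is \<open>|B|\<close> when the average of such a map is
  expanded in the isometries belonging to \<open>B\<close>.
\<close>

section \<open>Endomorphisms of a euclidean \<open>G\<close>-space\<close>

context euclidean_G_space
begin

lemma linear_act: "g \<in> carrier G \<Longrightarrow> linear (\<lambda>v. act v g)"
  using orthogonal_act[of g] by (simp add: orthogonal_transformation_def)

lemmas act_zero = linear_0[OF linear_act]
  and act_add = linear_add[OF linear_act]
  and act_scaleR = linear_scale[OF linear_act]
  and act_sum = linear_sum[OF linear_act]

lemma inner_act: "g \<in> carrier G \<Longrightarrow> act u g \<bullet> act v g = u \<bullet> v"
  using orthogonal_act[of g] by (simp add: orthogonal_transformation_def)

lemma act_inv_cancel [simp]: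
  "g \<in> carrier G \<Longrightarrow> act (act v (inv g)) g = v"
  "g \<in> carrier G \<Longrightarrow> act (act v g) (inv g) = v"
  by (simp_all flip: act_mult add: act_one)

lemma inner_act_inv: "g \<in> carrier G \<Longrightarrow> act u (inv g) \<bullet> v = u \<bullet> act v g"
  using inner_act[of g "act u (inv g)" v] by simp

lemma subspace_Fix:
  assumes "H \<subseteq> carrier G"
  shows "subspace (Fix act H)"
  unfolding subspace_def Fix_def
  using assms by (auto simp: act_zero act_add act_scaleR subset_iff)

abbreviation endos :: "('a \<Rightarrow> 'a) set" where
  "endos \<equiv> End_RG G act"

lemma endos_linear: "f \<in> endos \<Longrightarrow> linear f"
  by (simp add: End_RG_def)

lemma endos_act: "f \<in> endos \<Longrightarrow> g \<in> carrier G \<Longrightarrow> f (act v g) = act (f v) g"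
  by (simp add: End_RG_def)

lemma endos_zero: "(\<lambda>v. 0) \<in> endos"
  by (auto simp: End_RG_def act_zero linear_zero)

lemma endos_scaleR: "(\<lambda>v. r *\<^sub>R v) \<in> endos"
  by (auto simp: End_RG_def act_scaleR)

lemma endos_add: "f \<in> endos \<Longrightarrow> f' \<in> endos \<Longrightarrow> (\<lambda>v. f v + f' v) \<in> endos"
  by (auto simp: End_RG_def act_add intro: linear_compose_add)

lemma endos_comp: "f \<in> endos \<Longrightarrow> f' \<in> endos \<Longrightarrow> (\<lambda>v. f (f' v)) \<in> endos"
  using linear_compose[of f' f] by (auto simp: End_RG_def o_def)

lemma endos_scale: "f \<in> endos \<Longrightarrow> (\<lambda>v. r *\<^sub>R f v) \<in> endos"
  using endos_comp[OF endos_scaleR] .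

lemma endos_sum:
  assumes "\<And>i. i \<in> I \<Longrightarrow> f i \<in> endos"
  shows "(\<lambda>v. \<Sum>i\<in>I. f i v) \<in> endos"
  using assms
  by (induction I rule: infinite_finite_induct) (auto simp: endos_zero endos_add)

text \<open>\<open>G\<close> acts by orthogonal maps, so \<open>g\<close> and its adjoint \<open>g\<inverse>\<close> both commute with an
  endomorphism.\<close>

lemma endos_adjoint:
  assumes f: "f \<in> endos"
  shows "adjoint f \<in> endos"
proof -
  note adj = adjoint_works[OF endos_linear[OF f]]
  have "adjoint f (act v g) = act (adjoint f v) g" if g: "g \<in> carrier G" for v g
  proof (rule vector_eq_ldot[THEN iffD1], rule allI)
    fix x
    have "x \<bullet> adjoint f (act v g) = f x \<bullet> act v g"
      by (simp add: adj)
    also have "\<dots> = f (act x (inv g)) \<bullet> v"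
      using g by (simp add: endos_act[OF f] inner_act_inv)
    also have "\<dots> = act x (inv g) \<bullet> adjoint f v"
      by (simp add: adj)
    also have "\<dots> = x \<bullet> act (adjoint f v) g"
      using g by (simp add: inner_act_inv)
    finally show "x \<bullet> adjoint f (act v g) = x \<bullet> act (adjoint f v) g" .
  qed
  then show ?thesis
    using adjoint_linear[OF endos_linear[OF f]] by (simp add: End_RG_def)
qed

text \<open>The conjugates by \<open>G\<close> of the rank one map \<open>v \<mapsto> \<langle>v, b\<rangle> c\<close> are the maps
  \<open>v \<mapsto> \<langle>v, b g\<rangle> (c g)\<close>.\<close>

definition avg_rank_one :: "'a \<Rightarrow> 'a \<Rightarrow> 'a \<Rightarrow> 'a" where
  "avg_rank_one b c v =
    (1 / real (card (carrier G))) *\<^sub>R (\<Sum>g\<in>carrier G. (v \<bullet> act b g) *\<^sub>R act c g)"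

lemma inner_avg_rank_one:
  "avg_rank_one b c v \<bullet> x =
    (\<Sum>g\<in>carrier G. (v \<bullet> act b g) * (act c g \<bullet> x)) / real (card (carrier G))"
  by (simp add: avg_rank_one_def inner_sum_left)

lemma avg_rank_one_endo: "avg_rank_one b c \<in> endos"
proof -
  have lin: "linear (avg_rank_one b c)"
    unfolding avg_rank_one_def
    by (intro linearI)
      (simp_all add: inner_add_left scaleR_add_left sum.distrib scaleR_add_right
        scaleR_sum_right mult.assoc mult.left_commute)
  have "avg_rank_one b c (act v h) = act (avg_rank_one b c v) h" if h: "h \<in> carrier G" for v h
  proof -
    have "(\<Sum>g\<in>carrier G. (act v h \<bullet> act b g) *\<^sub>R act c g)
        = (\<Sum>g\<in>carrier G. (act v h \<bullet> act b (g \<otimes> h)) *\<^sub>R act c (g \<otimes> h))"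
      by (rule sum.reindex_bij_witness[of _ "\<lambda>g. g \<otimes> h" "\<lambda>g. g \<otimes> inv h"])
        (use h in \<open>auto simp: m_assoc\<close>)
    also have "\<dots> = (\<Sum>g\<in>carrier G. (v \<bullet> act b g) *\<^sub>R act (act c g) h)"
      by (rule sum.cong) (use h in \<open>auto simp: act_mult inner_act\<close>)
    finally show ?thesis
      using h by (simp add: avg_rank_one_def act_scaleR act_sum)
  qed
  with lin show ?thesis by (simp add: End_RG_def)
qed

end


section \<open>Schur's lemma\<close>

text \<open>A nonnegative quadratic form satisfies the Cauchy--Schwarz inequality, so its isotropic
  vectors lie in its kernel.\<close>

lemma psd_isotropic_in_kernel:
  fixes f :: "'a::real_inner \<Rightarrow> 'a"
  assumes lin: "linear f" and sym: "\<And>x y. f x \<bullet> y = x \<bullet> f y"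
    and nonneg: "\<And>x. f x \<bullet> x \<ge> 0" and iso: "f v \<bullet> v = 0"
  shows "f v = 0"
proof (rule ccontr)
  assume "f v \<noteq> 0"
  define a where "a = f v \<bullet> f v"
  define c where "c = f (f v) \<bullet> f v"
  have a: "a > 0" using \<open>f v \<noteq> 0\<close> by (simp add: a_def)
  have c: "c \<ge> 0" using nonneg by (simp add: c_def)
  (* the form takes the value 2 t a + t^2 c at v + t f(v), which is negative for small t < 0 *)
  have val: "0 \<le> t * (2 * a + t * c)" for t
  proof -
    have "f (v + t *\<^sub>R f v) \<bullet> (v + t *\<^sub>R f v) = t * (2 * a + t * c)"
      using iso by (simp add: linear_add[OF lin] linear_scale[OF lin] inner_add_left
        inner_add_right a_def c_def sym[of "f v" v] algebra_simps)
    then show ?thesis using nonneg by metis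
  qed
  have "0 < 2 * a + (- a / (c + 1)) * c"
  proof -
    have "(a / (c + 1)) * c \<le> a" using a c by (simp add: field_simps)
    then show ?thesis using a by simp
  qed
  moreover have "- a / (c + 1) < 0" using a c by simp
  ultimately show False
    using val[of "- a / (c + 1)"] by (meson mult_neg_pos not_less)
qed

context simple_euclidean_G_space
begin

text \<open>Let \<open>c\<close> be the maximum of \<open>\<langle>f v, v\<rangle>\<close> on the unit sphere. Then \<open>c - f\<close> is a nonnegative
  endomorphism with nonzero kernel, and by simplicity its kernel is the whole space.\<close>

lemma Schur_self_adjoint:
  assumes f: "f \<in> endos" and sym: "\<And>x y. f x \<bullet> y = x \<bullet> f y"
  shows "\<exists>c. \<forall>v. f v = c *\<^sub>R v"
proof -
  note lin = endos_linear[OF f]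
  have "continuous_on (sphere 0 1) (\<lambda>v. f v \<bullet> v)"
    using lin by (intro continuous_intros linear_continuous_on linear_linear[THEN iffD2])
  moreover have "sphere (0::'c) 1 \<noteq> {}" by simp
  ultimately obtain v where v: "norm v = 1" and max: "\<And>x. norm x = 1 \<Longrightarrow> f x \<bullet> x \<le> f v \<bullet> v"
    using continuous_attains_sup[of "sphere (0::'c) 1" "\<lambda>v. f v \<bullet> v"] by auto
  define c where "c = f v \<bullet> v"
  define h where "h = (\<lambda>x. c *\<^sub>R x + (-1) *\<^sub>R f x)"
  have h: "h \<in> endos"
    unfolding h_def by (intro endos_add endos_scale[OF f] endos_scaleR)
  have h_nonneg: "h x \<bullet> x \<ge> 0" for x
  proof (cases "x = 0")
    case False
    have "f (x /\<^sub>R norm x) \<bullet> (x /\<^sub>R norm x) \<le> c"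
      unfolding c_def using False by (intro max) simp
    then have "f x \<bullet> x \<le> c * (norm x)\<^sup>2"
      using False by (simp add: linear_scale[OF lin] field_simps power2_eq_square)
    then show ?thesis
      by (simp add: h_def inner_diff_left power2_norm_eq_inner)
  qed (simp add: h_def)
  have "h v = 0"
  proof (rule psd_isotropic_in_kernel[OF endos_linear[OF h] _ h_nonneg])
    show "h x \<bullet> y = x \<bullet> h y" for x y
      by (simp add: h_def inner_diff_left inner_diff_right sym)
    have "v \<bullet> v = 1" using v by (simp add: norm_eq_1)
    then show "h v \<bullet> v = 0" by (simp add: h_def inner_diff_left c_def)
  qed
  moreover have "{x. h x = 0} = {0} \<or> {x. h x = 0} = UNIV"
    by (rule simple)
      (auto simp: linear_subspace_kernel[OF endos_linear[OF h]] endos_act[OF h]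
        act_zero)
  moreover have "v \<noteq> 0" using v by auto
  ultimately have "h x = 0" for x by blast
  then have "f x = c *\<^sub>R x" for x by (simp add: h_def)
  then show ?thesis by blast
qed

text \<open>The form \<open>\<langle>d v, e v\<rangle> = \<langle>e\<^sup>* d v, v\<rangle>\<close> depends only on the symmetric part of \<open>e\<^sup>* d\<close>, to
  which Schur's lemma applies.\<close>

lemma End_RG_inner_scalar:
  assumes d: "d \<in> endos" and e: "e \<in> endos"
  shows "\<exists>c. \<forall>v. d v \<bullet> e v = c * (v \<bullet> v)"
proof -
  let ?f = "\<lambda>v. adjoint e (d v) + adjoint d (e v)"
  note adj = adjoint_works[OF endos_linear[OF d]] adjoint_works[OF endos_linear[OF e]]
    adjoint_clauses(2)[OF endos_linear[OF d]] adjoint_clauses(2)[OF endos_linear[OF e]]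
  have f: "?f \<in> endos"
    by (rule endos_add[OF endos_comp[OF endos_adjoint[OF e] d]
          endos_comp[OF endos_adjoint[OF d] e]])
  have sym: "?f x \<bullet> y = x \<bullet> ?f y" for x y
    by (simp add: inner_add_left inner_add_right adj)
  obtain c where c: "\<And>v. ?f v = c *\<^sub>R v"
    using Schur_self_adjoint[OF f sym] by auto
  have "d v \<bullet> e v = (c / 2) * (v \<bullet> v)" for v
  proof -
    have "?f v \<bullet> v = 2 * (d v \<bullet> e v)"
      by (simp add: inner_add_left adj inner_commute[of "e v" "d v"])
    then show ?thesis by (simp add: c)
  qed
  then show ?thesis by blast
qed

lemma End_RG_conformal:
  assumes d: "d \<in> endos"
  shows "\<exists>c. \<forall>x y. d x \<bullet> d y = c * (x \<bullet> y)"
proof -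
  obtain c where c: "\<And>v. d v \<bullet> d v = c * (v \<bullet> v)"
    using End_RG_inner_scalar[OF d d] by auto
  have "d x \<bullet> d y = c * (x \<bullet> y)" for x y
    using c[of x] c[of y] c[of "x + y"]
    by (simp add: linear_add[OF endos_linear[OF d]] inner_add_left inner_add_right
        inner_commute algebra_simps)
  then show ?thesis by blast
qed

lemma End_RG_isometry:
  assumes d: "d \<in> endos" and "w \<bullet> w = 1" and "d w \<bullet> d w = 1"
  shows "d x \<bullet> d y = x \<bullet> y"
proof -
  obtain c where c: "\<And>x y. d x \<bullet> d y = c * (x \<bullet> y)"
    using End_RG_conformal[OF d] by auto
  then have "c = 1" using assms(2,3) by (metis mult.right_neutral)
  with c show ?thesis by simp
qed

lemma End_RG_eqI:
  assumes d: "d \<in> endos" and e: "e \<in> endos" and w: "w \<noteq> 0" and eq: "d w = e w"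
  shows "d v = e v"
proof -
  let ?f = "\<lambda>v. d v + (-1) *\<^sub>R e v"
  have "?f \<in> endos" by (intro endos_add endos_scale d e)
  from End_RG_conformal[OF this] obtain c where c: "\<And>x y. ?f x \<bullet> ?f y = c * (x \<bullet> y)"
    by auto
  from c[of w w] w eq have "c = 0" by simp
  with c[of v v] show ?thesis by simp
qed

text \<open>A one-dimensional module over a division ring is generated by each of its nonzero vectors;
  the inverse of an endomorphism \<open>d\<close> is a real multiple of its adjoint.\<close>

lemma ring_dim_one_generator:
  assumes dim: "ring_dim endos W = 1" and w: "w \<in> W" "w \<noteq> 0"
    and v: "v \<in> W"
  obtains d where "d \<in> endos" "d w = v"
proof -
  define B where "B = (SOME B. ring_basis endos W B)"
  from dim have ex: "\<exists>B. ring_basis endos W B" and card: "card B = 1"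
    by (auto simp: ring_dim_def B_def split: if_splits)
  from ex have B: "ring_span endos B = W"
    unfolding B_def by (metis someI_ex ring_basis_def)
  from card obtain b where b: "B = {b}" by (auto simp: card_1_singleton_iff)
  have gen: "\<exists>d\<in>endos. x = d b" if x: "x \<in> W" for x
  proof -
    from x obtain T c where T: "T \<subseteq> {b}" "\<forall>b\<in>T. c b \<in> endos" "x = (\<Sum>b\<in>T. c b b)"
      unfolding B[symmetric] b ring_span_def by auto
    then consider "T = {}" | "T = {b}" by blast
    then show ?thesis
    proof cases
      case 1
      with T endos_zero show ?thesis by auto
    next
      case 2
      with T show ?thesis by auto
    qed
  qed
  obtain d where d: "d \<in> endos" "w = d b" using gen[OF w(1)] by blast
  obtain e where e: "e \<in> endos" "v = e b" using gen[OF v] by blast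
  obtain c where c: "\<And>x y. d x \<bullet> d y = c * (x \<bullet> y)"
    using End_RG_conformal[OF d(1)] by auto
  have "c \<noteq> 0" using c[of b b] w(2) d(2) by auto
  have "adjoint d w = c *\<^sub>R b"
  proof (rule vector_eq_ldot[THEN iffD1], rule allI)
    fix x
    show "x \<bullet> adjoint d w = x \<bullet> c *\<^sub>R b"
      by (simp add: adjoint_works[OF endos_linear[OF d(1)]] d(2) c)
  qed
  then have "e ((1 / c) *\<^sub>R adjoint d w) = v"
    using \<open>c \<noteq> 0\<close> e(2) by simp
  moreover have "(\<lambda>x. e ((1 / c) *\<^sub>R adjoint d x)) \<in> endos"
    by (rule endos_comp[OF e(1) endos_scale[OF endos_adjoint[OF d(1)]]])
  ultimately show thesis using that by blast
qed


section \<open>The norm of the character\<close>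

lemma char_inner_eq_trace_avg:
  "char_inner G (character_of act) (character_of act) =
    complex_of_real (\<Sum>b\<in>Basis. \<Sum>c\<in>Basis. avg_rank_one b c b \<bullet> c)"
proof -
  have "(\<Sum>b\<in>Basis. \<Sum>c\<in>Basis. avg_rank_one b c b \<bullet> c)
      = (\<Sum>b\<in>Basis. \<Sum>c\<in>Basis. \<Sum>g\<in>carrier G.
          (act b g \<bullet> b) * (act c g \<bullet> c) / real (card (carrier G)))"
    by (simp add: inner_avg_rank_one sum_divide_distrib inner_commute[of _ "act _ _"])
  also have "\<dots> = (\<Sum>b\<in>Basis. \<Sum>g\<in>carrier G. \<Sum>c\<in>Basis.
          (act b g \<bullet> b) * (act c g \<bullet> c) / real (card (carrier G)))"
    by (intro sum.cong[OF refl] sum.swap)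
  also have "\<dots> = (\<Sum>g\<in>carrier G. \<Sum>b\<in>Basis. \<Sum>c\<in>Basis.
          (act b g \<bullet> b) * (act c g \<bullet> c) / real (card (carrier G)))"
    by (rule sum.swap)
  also have "\<dots> = (1 / real (card (carrier G))) *
      (\<Sum>g\<in>carrier G. (\<Sum>b\<in>Basis. act b g \<bullet> b) * (\<Sum>c\<in>Basis. act c g \<bullet> c))"
    by (simp add: sum_product sum_divide_distrib)
  finally show ?thesis
    by (simp add: char_inner_def character_of_def)
qed

text \<open>By \<open>End_RG_inner_scalar\<close> the left-hand side is the same for all unit vectors \<open>w\<close>, so it is
  \<open>1 / DIM('c)\<close> times the trace of \<open>e\<^sup>* avg_rank_one b c\<close>, which averaging over \<open>G\<close> leaves
  unchanged because \<open>e\<close> commutes with the isometries in \<open>G\<close>.\<close>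

lemma inner_avg_rank_one_endo:
  assumes fin: "finite (carrier G)" and e: "e \<in> endos" and w: "w \<bullet> w = 1"
  shows "avg_rank_one b c w \<bullet> e w = (c \<bullet> e b) / DIM('c)"
proof -
  obtain k where k: "\<And>v. avg_rank_one b c v \<bullet> e v = k * (v \<bullet> v)"
    using End_RG_inner_scalar[OF avg_rank_one_endo[of b c] e] by auto
  have "k * DIM('c) = (\<Sum>x\<in>Basis. avg_rank_one b c x \<bullet> e x)"
    by (simp add: k inner_Basis)
  also have "\<dots> = (1 / real (card (carrier G))) *
      (\<Sum>x\<in>Basis. \<Sum>g\<in>carrier G. (x \<bullet> act b g) * (act c g \<bullet> e x))"
    by (simp add: inner_avg_rank_one sum_divide_distrib)
  also have "\<dots> = (1 / real (card (carrier G))) *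
      (\<Sum>g\<in>carrier G. \<Sum>x\<in>Basis. (x \<bullet> act b g) * (act c g \<bullet> e x))"
    by (subst sum.swap) simp
  also have "(\<Sum>g\<in>carrier G. \<Sum>x\<in>Basis. (x \<bullet> act b g) * (act c g \<bullet> e x))
      = (\<Sum>g\<in>carrier G. c \<bullet> e b)"
  proof (rule sum.cong[OF refl])
    fix g assume g: "g \<in> carrier G"
    have "(\<Sum>x\<in>Basis. (x \<bullet> act b g) * (act c g \<bullet> e x))
        = act c g \<bullet> e (\<Sum>x\<in>Basis. (act b g \<bullet> x) *\<^sub>R x)"
      by (simp add: linear_sum[OF endos_linear[OF e]] linear_scale[OF endos_linear[OF e]]
          inner_sum_right inner_commute)
    also have "\<dots> = act c g \<bullet> e (act b g)"
      by (simp only: euclidean_representation)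
    also have "\<dots> = c \<bullet> e b"
      using g by (simp add: endos_act[OF e] inner_act)
    finally show "(\<Sum>x\<in>Basis. (x \<bullet> act b g) * (act c g \<bullet> e x)) = c \<bullet> e b" .
  qed
  also have "(1 / real (card (carrier G))) * (\<Sum>g\<in>carrier G. c \<bullet> e b) = c \<bullet> e b"
    using fin one_closed by (auto simp: card_eq_0_iff)
  finally have "k = (c \<bullet> e b) / DIM('c)"
    by (simp add: field_simps)
  with k[of w] w show ?thesis by simp
qed

text \<open>The map \<open>f \<mapsto> f w\<close> embeds the endomorphism ring into the space, so the average of a rank
  one map is recovered from its value at \<open>w\<close>, and this value is expanded in \<open>B\<close>.\<close>

lemma char_norm_eq_card:
  assumes fin: "finite (carrier G)" and w: "w \<bullet> w = 1"
    and B: "pairwise orthogonal B" "\<And>u. u \<in> B \<Longrightarrow> norm u = 1"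
    and span: "span B = (\<lambda>f. f w) ` endos"
  shows "char_inner G (character_of act) (character_of act) = of_nat (card B)"
proof -
  have "finite B"
    using B by (metis finiteI_independent pairwise_orthogonal_independent norm_zero zero_neq_one)
  have "\<exists>f\<in>endos. f w = u" if "u \<in> B" for u
    using that span_base[of u B] unfolding span by auto
  then obtain d where d: "\<And>u. u \<in> B \<Longrightarrow> d u \<in> endos" "\<And>u. u \<in> B \<Longrightarrow> d u w = u"
    by metis
  have isom: "d u x \<bullet> d u y = x \<bullet> y" if "u \<in> B" for u x y
    using End_RG_isometry[OF d(1)[OF that] w] d(2)[OF that] B(2)[OF that]
    by (simp add: norm_eq_1)
  have expand: "avg_rank_one b c v = (\<Sum>u\<in>B. ((c \<bullet> d u b) / DIM('c)) *\<^sub>R d u v)" for b c v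
  proof (rule End_RG_eqI[OF avg_rank_one_endo])
    show "(\<lambda>v. \<Sum>u\<in>B. ((c \<bullet> d u b) / DIM('c)) *\<^sub>R d u v) \<in> endos"
      by (intro endos_sum endos_scale d)
    show "w \<noteq> 0" using w by auto
    have "avg_rank_one b c w \<in> span B"
      unfolding span using avg_rank_one_endo by blast
    then have "avg_rank_one b c w = (\<Sum>u\<in>B. (avg_rank_one b c w \<bullet> u) *\<^sub>R u)"
      using orthonormal_basis_expand[OF B _ \<open>finite B\<close>] by metis
    also have "\<dots> = (\<Sum>u\<in>B. ((c \<bullet> d u b) / DIM('c)) *\<^sub>R d u w)"
      by (rule sum.cong[OF refl]) (use inner_avg_rank_one_endo[OF fin d(1) w] d(2) in metis)
    finally show "avg_rank_one b c w = (\<Sum>u\<in>B. ((c \<bullet> d u b) / DIM('c)) *\<^sub>R d u w)" .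
  qed
  have "(\<Sum>b\<in>Basis. \<Sum>c\<in>Basis. avg_rank_one b c b \<bullet> c)
      = (\<Sum>b\<in>Basis. \<Sum>c\<in>Basis. \<Sum>u\<in>B. (d u b \<bullet> c) * (d u b \<bullet> c) / DIM('c))"
    by (simp add: expand inner_sum_right inner_commute)
  also have "\<dots> = (\<Sum>b\<in>Basis. \<Sum>u\<in>B. \<Sum>c\<in>Basis. (d u b \<bullet> c) * (d u b \<bullet> c) / DIM('c))"
    by (intro sum.cong[OF refl] sum.swap)
  also have "\<dots> = (\<Sum>b\<in>(Basis::'c set). \<Sum>u\<in>B. 1 / DIM('c))"
  proof (intro sum.cong refl)
    fix b :: 'c and u assume "b \<in> Basis" "u \<in> B"
    then have "(\<Sum>c\<in>Basis. (d u b \<bullet> c) * (d u b \<bullet> c)) = 1"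
      using isom[of u b b] by (simp add: inner_Basis flip: euclidean_inner)
    then show "(\<Sum>c\<in>Basis. (d u b \<bullet> c) * (d u b \<bullet> c) / DIM('c)) = 1 / DIM('c)"
      by (simp flip: sum_divide_distrib)
  qed
  also have "\<dots> = card B" by simp
  finally show ?thesis by (simp add: char_inner_eq_trace_avg)
qed

end


section \<open>The compressed trace\<close>

context euclidean_G_space
begin

text \<open>The average lies in \<open>Fix act H\<close>, and it has the same inner product as \<open>b\<close> with every vector
  fixed by \<open>H\<close>, so it is the orthogonal projection of \<open>b\<close>.\<close>

lemma average_eq_projection:
  assumes H: "subgroup H G" and fin: "finite H"
    and B: "pairwise orthogonal B" "\<And>u. u \<in> B \<Longrightarrow> norm u = 1" "finite B"
    and span: "span B = Fix act H"
  shows "(1 / real (card H)) *\<^sub>R (\<Sum>h\<in>H. act b h) = (\<Sum>u\<in>B. (b \<bullet> u) *\<^sub>R u)"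
proof -
  let ?p = "(1 / real (card H)) *\<^sub>R (\<Sum>h\<in>H. act b h)"
  note Hc = subgroup.mem_carrier[OF H]
  have "?p \<in> Fix act H"
    unfolding Fix_def
  proof safe
    fix k assume k: "k \<in> H"
    have "act ?p k = (1 / real (card H)) *\<^sub>R (\<Sum>h\<in>H. act b (h \<otimes> k))"
      using Hc k by (simp add: act_scaleR act_sum act_mult)
    also have "(\<Sum>h\<in>H. act b (h \<otimes> k)) = (\<Sum>h\<in>H. act b h)"
      by (rule sum.reindex_bij_witness[of _ "\<lambda>h. h \<otimes> inv k" "\<lambda>h. h \<otimes> k"])
        (use k Hc in \<open>auto simp: m_assoc subgroup.m_closed[OF H] subgroup.m_inv_closed[OF H]\<close>)
    finally show "act ?p k = ?p" .
  qed
  then have "?p = (\<Sum>u\<in>B. (?p \<bullet> u) *\<^sub>R u)"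
    using orthonormal_basis_expand[OF B(1,2) _ B(3)] span by metis
  also have "\<dots> = (\<Sum>u\<in>B. (b \<bullet> u) *\<^sub>R u)"
  proof (intro sum.cong refl)
    fix u assume "u \<in> B"
    then have u: "u \<in> Fix act H" using span span_base by blast
    have "act b h \<bullet> u = b \<bullet> u" if "h \<in> H" for h
      using inner_act[OF Hc[OF that], of b u] u that by (simp add: Fix_def)
    moreover have "card H \<noteq> 0"
      using fin subgroup.one_closed[OF H] by auto
    ultimately show "(?p \<bullet> u) *\<^sub>R u = (b \<bullet> u) *\<^sub>R u"
      by (simp add: inner_sum_left)
  qed
  finally show ?thesis .
qed

text \<open>The left-hand side is the trace of \<open>v \<mapsto> v e\<^sub>H g\<close>, the projection onto \<open>Fix act H\<close>
  followed by \<open>g\<close>.\<close>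

lemma character_idem_mult:
  assumes fin: "finite (carrier G)" and H: "subgroup H G" and g: "g \<in> carrier G"
    and B: "pairwise orthogonal B" "\<And>u. u \<in> B \<Longrightarrow> norm u = 1" "finite B"
    and span: "span B = Fix act H"
  shows "gr_extend G (character_of act) (gr_mult G (gr_idem H) (gr_single g)) =
    complex_of_real (\<Sum>u\<in>B. act u g \<bullet> u)"
proof -
  note Hc = subgroup.mem_carrier[OF H]
  have finH: "finite H" using fin subgroup.subset[OF H] finite_subset by blast
  have "(1 / real (card H)) * (\<Sum>h\<in>H. \<Sum>b\<in>Basis. act b (h \<otimes> g) \<bullet> b)
      = (\<Sum>b\<in>Basis. (1 / real (card H)) * (\<Sum>h\<in>H. act (act b h) g \<bullet> b))"
    using g Hc by (subst sum.swap) (simp add: sum_distrib_left act_mult)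
  also have "\<dots> = (\<Sum>b\<in>Basis. act ((1 / real (card H)) *\<^sub>R (\<Sum>h\<in>H. act b h)) g \<bullet> b)"
    using g by (simp add: act_scaleR act_sum inner_sum_left)
  also have "\<dots> = (\<Sum>b\<in>Basis. \<Sum>u\<in>B. (b \<bullet> u) * (act u g \<bullet> b))"
    by (simp only: average_eq_projection[OF H finH B span] act_scaleR[OF g]
        act_sum[OF g] inner_sum_left inner_scaleR_left)
  also have "\<dots> = (\<Sum>u\<in>B. \<Sum>b\<in>Basis. (act u g \<bullet> b) * (u \<bullet> b))"
    by (subst sum.swap) (simp add: inner_commute mult.commute)
  also have "\<dots> = (\<Sum>u\<in>B. act u g \<bullet> u)"
    by (simp flip: euclidean_inner)
  finally have "(1 / real (card H)) * (\<Sum>h\<in>H. \<Sum>b\<in>Basis. act b (h \<otimes> g) \<bullet> b)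
      = (\<Sum>u\<in>B. act u g \<bullet> u)" .
  then have "complex_of_real ((1 / real (card H)) * (\<Sum>h\<in>H. \<Sum>b\<in>Basis. act b (h \<otimes> g) \<bullet> b))
      = complex_of_real (\<Sum>u\<in>B. act u g \<bullet> u)"
    by (rule arg_cong)
  then show ?thesis
    unfolding gr_extend_idem_single[OF is_group fin subgroup.subset[OF H] g] character_of_def
    by simp
qed

end


section \<open>Point stabilizers and the inner product formula\<close>

lemma (in right_G_set) subgroup_right_stabilizer:
  assumes "x \<in> \<Omega>"
  shows "subgroup (right_stabilizer G act x) G"
proof (rule subgroupI)
  show "right_stabilizer G act x \<noteq> {}"
    using assms act_one by (auto simp: right_stabilizer_def)
  fix a assume a: "a \<in> right_stabilizer G act x"
  then have "act x (inv a) = act (act x a) (inv a)" and "a \<in> carrier G"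
    by (simp_all add: right_stabilizer_def)
  then have "act x (inv a) = x"
    using assms by (simp flip: act_mult add: act_one)
  then show "inv a \<in> right_stabilizer G act x"
    using a by (simp add: right_stabilizer_def)
qed (use assms in \<open>auto simp: right_stabilizer_def act_mult\<close>)

theorem corollary6p2:
  fixes G :: "('g, 'm) monoid_scheme" (structure)
    and \<Omega> :: "'x set" and act\<Omega> :: "'x \<Rightarrow> 'g \<Rightarrow> 'x" and \<alpha> :: 'x and H :: "'g set"
    and act :: "'a::euclidean_space \<Rightarrow> 'g \<Rightarrow> 'a" and \<sigma> :: "'g \<Rightarrow> complex"
    and w :: 'a and g :: 'g
  assumes "group G" and "finite (carrier G)"
    and "transitive_right_G_set G \<Omega> act\<Omega>" and "\<alpha> \<in> \<Omega>"
    and "H = right_stabilizer G act\<Omega> \<alpha>"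
    and "simple_euclidean_G_space G act"
    and "\<sigma> = character_of act"
    and "essential_Wythoff_dim G act H = 1"
    and "w \<in> Fix act H" and "w \<bullet> w = 1"
    and "g \<in> carrier G"
  shows "complex_of_real (act w g \<bullet> w) =
    gr_extend G \<sigma> (gr_mult G (gr_idem H) (gr_single g)) / char_inner G \<sigma> \<sigma>"
proof -
  interpret \<Omega>: transitive_right_G_set G \<Omega> act\<Omega> by fact
  interpret S: simple_euclidean_G_space G act by fact
  have H: "subgroup H G"
    unfolding assms(5) using assms(4) by (rule \<Omega>.subgroup_right_stabilizer)
  have "w \<noteq> 0" using assms(10) by auto
  have dim: "ring_dim S.endos (Fix act H) = 1"
    using assms(8) by (simp add: essential_Wythoff_dim_def)
  have W: "Fix act H = (\<lambda>f. f w) ` S.endos"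
  proof
    show "Fix act H \<subseteq> (\<lambda>f. f w) ` S.endos"
      using S.ring_dim_one_generator[OF dim assms(9) \<open>w \<noteq> 0\<close>] by blast
    show "(\<lambda>f. f w) ` S.endos \<subseteq> Fix act H"
      using assms(9) subgroup.mem_carrier[OF H] S.endos_act unfolding Fix_def
      by (smt (verit) image_iff mem_Collect_eq subsetI)
  qed
  obtain B where B: "pairwise orthogonal B" "\<And>u. u \<in> B \<Longrightarrow> norm u = 1"
    and ind: "independent B" and span: "span B = Fix act H"
    using orthonormal_basis_subspace[OF S.subspace_Fix[OF subgroup.subset[OF H]]] by metis
  have "finite B" using ind by (rule finiteI_independent)
  have "act u g \<bullet> u = act w g \<bullet> w" if u: "u \<in> B" for u
  proof -
    obtain d where d: "d \<in> S.endos" "d w = u"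
      using span_base[OF u] unfolding span W by auto
    have "d w \<bullet> d w = 1"
      using d(2) B(2)[OF u] by (simp add: norm_eq_1)
    then have "d (act w g) \<bullet> d w = act w g \<bullet> w"
      by (rule S.End_RG_isometry[OF d(1) assms(10)])
    then show ?thesis
      by (simp add: S.endos_act[OF d(1) assms(11)] d(2))
  qed
  then have "gr_extend G \<sigma> (gr_mult G (gr_idem H) (gr_single g))
      = of_nat (card B) * complex_of_real (act w g \<bullet> w)"
    using S.character_idem_mult[OF assms(2) H assms(11) B \<open>finite B\<close> span]
    by (simp add: assms(7))
  moreover have "char_inner G \<sigma> \<sigma> = of_nat (card B)"
    unfolding assms(7) using S.char_norm_eq_card[OF assms(2,10) B] span W by simp
  moreover have "card B \<noteq> 0"
  proof
    assume "card B = 0"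
    with \<open>finite B\<close> have "span B = {0}" by simp
    with span assms(9) \<open>w \<noteq> 0\<close> show False by blast
  qed
  ultimately show ?thesis by simp
qed

end
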